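(* Let $p_X, p_Y \in [0,1]$, let $T \ge 1$ be an integer and let $\delta$ be an integer with $0 \le \delta \le T$. Let $X_1,\dots,X_T$ be i.i.d. Bernoulli($p_X$) and $Y_1,\dots,Y_T$ be i.i.d. Bernoulli($p_Y$) random variables, with the two sequences independent of each other. Let $$S_{T,\delta} = \{(i,j) \in \{1,\dots,T\}^2 : |i-j| \le \delta,\ X_i = Y_j = 1\}$$ and let $|S_{T,\delta}|$ be its cardinality. Then $$\mathbb{E}(|S_{T,\delta}|) = p_X p_Y \big( T(2\delta+1) - \delta(\delta+1)\big).$$
   Context: Bernoulli($p$) random variables take value $1$ with probability $p$ and $0$ with probability $1-p$. *)

theory Defs
  imports "HOL-Probability.Probability"
begin

definition bernoulli_rv :: "'a measure \<Rightarrow> real \<Rightarrow> ('a \<Rightarrow> real) \<Rightarrow> bool" where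
  "bernoulli_rv M p Z \<longleftrightarrow>
     Z \<in> borel_measurable M \<and>
     measure M {\<omega> \<in> space M. Z \<omega> = 1} = p \<and>
     measure M {\<omega> \<in> space M. Z \<omega> = 0} = 1 - p"

text \<open>
  The two sequences are independent as random vectors: the tuples \<open>(X\<^sub>1, \<dots>, X\<^sub>T)\<close> and
  \<open>(Y\<^sub>1, \<dots>, Y\<^sub>T)\<close> are independent random variables with values in the product space.
\<close>

definition indep_seqs ::
    "'a measure \<Rightarrow> nat \<Rightarrow> (nat \<Rightarrow> 'a \<Rightarrow> real) \<Rightarrow> (nat \<Rightarrow> 'a \<Rightarrow> real) \<Rightarrow> bool" where
  "indep_seqs M T X Y \<longleftrightarrow>
     prob_space.indep_var M
       (Pi\<^sub>M {1..T} (\<lambda>_. borel)) (\<lambda>\<omega>. \<lambda>i\<in>{1..T}. X i \<omega>)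
       (Pi\<^sub>M {1..T} (\<lambda>_. borel)) (\<lambda>\<omega>. \<lambda>j\<in>{1..T}. Y j \<omega>)"

definition coincidence_set ::
    "nat \<Rightarrow> nat \<Rightarrow> (nat \<Rightarrow> 'a \<Rightarrow> real) \<Rightarrow> (nat \<Rightarrow> 'a \<Rightarrow> real) \<Rightarrow> 'a \<Rightarrow> (nat \<times> nat) set" where
  "coincidence_set T \<delta> X Y \<omega> =
     {(i, j) \<in> {1..T} \<times> {1..T}. \<bar>int i - int j\<bar> \<le> int \<delta> \<and> X i \<omega> = 1 \<and> Y j \<omega> = 1}"

end

theory Submission
  imports Defs
begin

text \<open>
  By linearity of expectation, the expected number of coincidences is the sum, over the pairs
  \<open>(i, j)\<close> in the diagonal band \<open>\<bar>i - j\<bar> \<le> \<delta>\<close> of the square \<open>{1..T}\<^sup>2\<close>, of the probabilities that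
  \<open>X\<^sub>i = Y\<^sub>j = 1\<close>. Independence of the two sequences makes each of these probabilities
  \<open>p_X * p_Y\<close> (\<open>prob_coincidence\<close>). It remains to count the band (\<open>card_band\<close>):
  the main diagonal has \<open>T\<close> points and the two diagonals at distance \<open>k\<close> from it
  have \<open>T - k\<close> points each, so for \<open>\<delta> \<le> T\<close> the band has
  \<open>T + 2 * (\<Sum>k=1..\<delta>. T - k) = T * (2 * \<delta> + 1) - \<delta> * (\<delta> + 1)\<close> points.
\<close>

definition band :: "nat \<Rightarrow> nat \<Rightarrow> (nat \<times> nat) set" where
  "band T \<delta> = {(i, j) \<in> {1..T} \<times> {1..T}. \<bar>int i - int j\<bar> \<le> int \<delta>}"

lemma finite_band: "finite (band T \<delta>)"
  by (rule finite_subset[of _ "{1..T} \<times> {1..T}"]) (auto simp: band_def)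

text \<open>Widening the band by one adds one diagonal on either side; both are parametrised by
  their smaller coordinate.\<close>

lemma band_Suc:
  "band T (Suc \<delta>) = band T \<delta> \<union>
     ((\<lambda>i. (i, i + Suc \<delta>)) ` {1..T - Suc \<delta>} \<union> (\<lambda>i. (i + Suc \<delta>, i)) ` {1..T - Suc \<delta>})"
  (is "?L = ?R")
proof
  show "?L \<subseteq> ?R"
  proof
    fix x assume x: "x \<in> ?L"
    obtain i j where ij: "x = (i, j)" by (cases x)
    have b: "i \<in> {1..T}" "j \<in> {1..T}" "\<bar>int i - int j\<bar> \<le> int (Suc \<delta>)"
      using x ij by (auto simp: band_def)
    then consider "\<bar>int i - int j\<bar> \<le> int \<delta>" | "j = i + Suc \<delta>" | "i = j + Suc \<delta>"
      by linarith
    then show "x \<in> ?R"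
    proof cases
      case 1
      then show ?thesis using b ij by (auto simp: band_def)
    next
      case 2
      moreover from 2 b have "i \<in> {1..T - Suc \<delta>}" by auto
      ultimately show ?thesis using ij by blast
    next
      case 3
      moreover from 3 b have "j \<in> {1..T - Suc \<delta>}" by auto
      ultimately show ?thesis using ij by blast
    qed
  qed
  show "?R \<subseteq> ?L"
    by (auto simp: band_def)
qed

lemma card_band:
  assumes "\<delta> \<le> T"
  shows "real (card (band T \<delta>)) = real T * (2 * real \<delta> + 1) - real \<delta> * (real \<delta> + 1)"
  using assms
proof (induction \<delta>)
  case 0
  have "band T 0 = (\<lambda>i. (i, i)) ` {1..T}"
    by (auto simp: band_def)
  then show ?case
    by (simp add: card_image inj_on_def)
next
  case (Suc \<delta>)
  let ?U = "(\<lambda>i. (i, i + Suc \<delta>)) ` {1..T - Suc \<delta>}"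
  let ?L = "(\<lambda>i. (i + Suc \<delta>, i)) ` {1..T - Suc \<delta>}"
  have "card ?U = T - Suc \<delta>" "card ?L = T - Suc \<delta>"
    by (simp_all add: card_image inj_on_def)
  moreover have "?U \<inter> ?L = {}" "band T \<delta> \<inter> (?U \<union> ?L) = {}"
    by (auto simp: band_def)
  ultimately have "card (band T (Suc \<delta>)) = card (band T \<delta>) + 2 * (T - Suc \<delta>)"
    unfolding band_Suc by (simp add: card_Un_disjoint finite_band)
  then show ?case
    using Suc by (simp add: of_nat_diff algebra_simps)
qed

text \<open>Independence of the two random vectors is applied to a cylinder set in each of the two
  product spaces, namely the set of vectors whose \<open>i\<close>-th (respectively \<open>j\<close>-th) entry is 1.\<close>

lemma prob_coincidence:
  assumes "prob_space M" and "indep_seqs M T X Y"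
    and i: "i \<in> {1..T}" and j: "j \<in> {1..T}"
    and X: "bernoulli_rv M p (X i)" and Y: "bernoulli_rv M q (Y j)"
  shows "measure M {\<omega> \<in> space M. X i \<omega> = 1 \<and> Y j \<omega> = 1} = p * q"
proof -
  interpret prob_space M by fact
  let ?P = "Pi\<^sub>M {1..T} (\<lambda>_. borel) :: (nat \<Rightarrow> real) measure"
  let ?A = "\<lambda>\<omega>. \<lambda>i\<in>{1..T}. X i \<omega>" and ?B = "\<lambda>\<omega>. \<lambda>j\<in>{1..T}. Y j \<omega>"
  let ?C = "\<lambda>k. (\<lambda>f. f k) -` {1} \<inter> space ?P"
  have ind: "indep_var ?P ?A ?P ?B"
    using assms(2) by (simp add: indep_seqs_def)
  have cyl: "?C k \<in> sets ?P" if "k \<in> {1..T}" for k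
    using that by (intro measurable_sets[OF measurable_component_singleton]) auto
  have "{\<omega> \<in> space M. X i \<omega> = 1 \<and> Y j \<omega> = 1} = (\<lambda>\<omega>. (?A \<omega>, ?B \<omega>)) -` (?C i \<times> ?C j) \<inter> space M"
    using i j by (auto simp: space_PiM)
  moreover have "?A -` ?C i \<inter> space M = {\<omega> \<in> space M. X i \<omega> = 1}"
    using i by (auto simp: space_PiM)
  moreover have "?B -` ?C j \<inter> space M = {\<omega> \<in> space M. Y j \<omega> = 1}"
    using j by (auto simp: space_PiM)
  ultimately show ?thesis
    using indep_varD[OF ind cyl[OF i] cyl[OF j]] X Y by (simp add: bernoulli_rv_def)
qed

theorem mainTheorem3:
  fixes M :: "'a measure"
    and X Y :: "nat \<Rightarrow> 'a \<Rightarrow> real"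
    and p_X p_Y :: real
    and T \<delta> :: nat
  assumes "prob_space M"
    and "p_X \<in> {0..1}" and "p_Y \<in> {0..1}"
    and "T \<ge> 1" and "\<delta> \<le> T"
    and "\<And>i. i \<in> {1..T} \<Longrightarrow> bernoulli_rv M p_X (X i)"
    and "\<And>j. j \<in> {1..T} \<Longrightarrow> bernoulli_rv M p_Y (Y j)"
    and "prob_space.indep_vars M (\<lambda>_. borel) X {1..T}"
    and "prob_space.indep_vars M (\<lambda>_. borel) Y {1..T}"
    and "indep_seqs M T X Y"
  shows "prob_space.expectation M (\<lambda>\<omega>. real (card (coincidence_set T \<delta> X Y \<omega>)))
       = p_X * p_Y * (real T * (2 * real \<delta> + 1) - real \<delta> * (real \<delta> + 1))"
proof -
  interpret prob_space M by fact
  define E where "E = (\<lambda>(i, j). {\<omega> \<in> space M. X i \<omega> = 1 \<and> Y j \<omega> = 1})"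
  have E_sets: "E x \<in> events" and E_prob: "prob (E x) = p_X * p_Y" if x_band: "x \<in> band T \<delta>" for x
  proof -
    obtain i j where x: "x = (i, j)" and i: "i \<in> {1..T}" and j: "j \<in> {1..T}"
      using x_band by (cases x) (auto simp: band_def)
    have [measurable]: "X i \<in> borel_measurable M" "Y j \<in> borel_measurable M"
      using assms(6)[OF i] assms(7)[OF j] by (simp_all add: bernoulli_rv_def)
    show "E x \<in> events"
      unfolding E_def x by simp
    show "prob (E x) = p_X * p_Y"
      unfolding E_def x
      using prob_coincidence[OF assms(1,10) i j assms(6)[OF i] assms(7)[OF j]] by simp
  qed
  have card_eq: "real (card (coincidence_set T \<delta> X Y \<omega>)) = (\<Sum>x\<in>band T \<delta>. indicator (E x) \<omega>)"
    if "\<omega> \<in> space M" for \<omega>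
  proof -
    have "coincidence_set T \<delta> X Y \<omega> = {x \<in> band T \<delta>. \<omega> \<in> E x}"
      using that by (auto simp: coincidence_set_def band_def E_def)
    then show ?thesis
      by (simp add: indicator_def sum.If_cases finite_band Int_def)
  qed
  have "expectation (\<lambda>\<omega>. real (card (coincidence_set T \<delta> X Y \<omega>)))
      = expectation (\<lambda>\<omega>. \<Sum>x\<in>band T \<delta>. indicator (E x) \<omega>)"
    by (intro Bochner_Integration.integral_cong refl card_eq)
  also have "\<dots> = (\<Sum>x\<in>band T \<delta>. expectation (indicator (E x)))"
    using E_sets
    by (intro Bochner_Integration.integral_sum integrable_real_indicator)
       (auto simp: emeasure_eq_measure)
  also have "\<dots> = (\<Sum>x\<in>band T \<delta>. p_X * p_Y)"
    using E_sets E_prob by (intro sum.cong) auto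
  also have "\<dots> = p_X * p_Y * real (card (band T \<delta>))"
    by simp
  finally show ?thesis
    using card_band[OF assms(5)] by simp
qed

end
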